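(* Let $i\in\{0,1,2,\dots\}$, let $x_i,x_{i+1}\in[l,r)$, and let $\hat x_{i+1}\in[\max(x_i,x_{i+1}),r)$. Let $P_i$ and $P_{i+1}=-f\,P_i/P_i'$ be the iterates defined in the context. (i) Suppose $P_i$ is an upper bound on $1-F$ on $(x_i,r)$ and $P_{i+1}$ is a lower bound on $1-F$ on $(x_{i+1},r)$, both in the sense of the context. Put $P_{L,i}(x)=2\bigl(1-F(x)\bigr)-P_i(x)$. If $$P_{i+1}'(x)+P_i'(x)+2f(x)\le 0\qquad\text{for all }x\in(\hat x_{i+1},r),$$ then $P_{i+1}$ is a tighter bound on $1-F$ than $P_i$ in the sense that $$P_{L,i}(x)\le P_{i+1}(x)\qquad\text{for all }x\in(\hat x_{i+1},r).$$ (ii) Suppose $P_i$ is a lower bound on $1-F$ on $(x_i,r)$ and $P_{i+1}$ is an upper bound on $1-F$ on $(x_{i+1},r)$, both in the sense of the context. Put $P_{U,i}(x)=2\bigl(1-F(x)\bigr)-P_i(x)$. If $$P_{i+1}'(x)+P_i'(x)+2f(x)\ge 0\qquad\text{for all }x\in(\hat x_{i+1},r),$$ then $P_{i+1}$ is a tighter bound on $1-F$ than $P_i$ in the sense that $$P_{U,i}(x)\ge P_{i+1}(x)\qquad\text{for all }x\in(\hat x_{i+1},r).$$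
   Context: $X$ is a continuous real random variable with cumulative distribution function $F(x)=\Pr\{X\le x\}$ and probability density function $f(x)=F'(x)$. The support of $f$ is an interval with endpoints $l$ and $r$, $-\infty\le l<r\le\infty$, each endpoint being included or not. The density $f$ is continuous on the support and its derivative $f'$ exists there; all functions are assumed differentiable as often as needed for the expressions below to make sense. Given a function $g$, the iterates are $$P_0(x)=-f(x)\frac{g(x)}{g'(x)},\qquad P_{i+1}(x)=-f(x)\frac{P_i(x)}{P_i'(x)},\quad i=0,1,2,\dots$$ Put $g_0=g$ and $g_j=P_{j-1}$ for $j\ge1$, so that $P_j=-f\,g_j/g_j'$ for every $j\ge 0$. "$P_j$ is an upper (respectively lower) bound on $1-F$ on $(a,r)$" means that it is obtained as such from the following criterion: $g_j$ is continuous, positive and strictly decreasing on $(a,r)$ with $g_j'(x)<0$ there, $\lim_{x\to r}P_j(x)=0$, and $P_j'(x)+f(x)\le 0$ (respectively $P_j'(x)+f(x)\ge 0$) for all $x\in(a,r)$; consequently $1-F(x)\le P_j(x)$ (respectively $1-F(x)\ge P_j(x)$) for all $x\in(a,r)$. *)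

theory Defs
  imports "HOL-Probability.Probability"
begin

text \<open>
  A real random variable \<open>X\<close> with density \<open>f\<close>, whose support \<open>{x. f x \<noteq> 0}\<close> is an interval with
  endpoints \<open>l < r\<close> in the extended reals; each finite endpoint may or may not belong to it.
  \<open>F' = f\<close> is required only between the endpoints, since \<open>F\<close> need not be differentiable at a
  finite endpoint (for instance for the exponential distribution at \<open>0\<close>).
\<close>

locale interval_density = prob_space M
  for M :: "'a measure" +
  fixes X :: "'a \<Rightarrow> real" and f :: "real \<Rightarrow> real" and l r :: ereal
  assumes distributed_X: "distributed M lborel X (\<lambda>x. ennreal (f x))"
    and density_nonneg: "\<And>x. 0 \<le> f x"
    and endpoints_less: "l < r"
    and einterval_subset_support: "einterval l r \<subseteq> support_on UNIV f"
    and support_subset: "support_on UNIV f \<subseteq> {x. l \<le> ereal x \<and> ereal x \<le> r}"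
    and density_continuous: "continuous_on (support_on UNIV f) f"
    and density_differentiable: "f differentiable_on (support_on UNIV f)"
    and cdf_deriv:
      "\<And>x. x \<in> einterval l r \<Longrightarrow> (cdf (distr M borel X) has_real_derivative f x) (at x)"

primrec iterate_P :: "(real \<Rightarrow> real) \<Rightarrow> (real \<Rightarrow> real) \<Rightarrow> nat \<Rightarrow> real \<Rightarrow> real" where
  "iterate_P f g 0 = (\<lambda>x. - f x * (g x / deriv g x))"
| "iterate_P f g (Suc i) = (\<lambda>x. - f x * (iterate_P f g i x / deriv (iterate_P f g i) x))"

definition iterate_g :: "(real \<Rightarrow> real) \<Rightarrow> (real \<Rightarrow> real) \<Rightarrow> nat \<Rightarrow> real \<Rightarrow> real" where
  "iterate_g f g j = (case j of 0 \<Rightarrow> g | Suc k \<Rightarrow> iterate_P f g k)"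

text \<open>
  The part of the bound criterion common to upper and lower bounds. Since \<open>deriv\<close> is total, the
  differentiability of \<open>g\<^sub>j\<close> and \<open>P\<^sub>j\<close> on \<open>(a, r)\<close>, which the criterion needs in order to make sense,
  is stated explicitly. The limit at the (possibly infinite) right endpoint is taken from the left.
\<close>

definition bound_regular ::
  "(real \<Rightarrow> real) \<Rightarrow> (real \<Rightarrow> real) \<Rightarrow> ereal \<Rightarrow> ereal \<Rightarrow> nat \<Rightarrow> bool" where
  "bound_regular f g a r j \<longleftrightarrow>
     continuous_on (einterval a r) (iterate_g f g j) \<and>
     (\<forall>x\<in>einterval a r. 0 < iterate_g f g j x) \<and>
     strict_antimono_on (einterval a r) (iterate_g f g j) \<and>
     (\<forall>x\<in>einterval a r. iterate_g f g j differentiable at x \<and> deriv (iterate_g f g j) x < 0) \<and>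
     (\<forall>x\<in>einterval a r. iterate_P f g j differentiable at x) \<and>
     ((iterate_P f g j \<circ> real_of_ereal) \<longlongrightarrow> 0) (at_left r)"

definition upper_bound_on ::
  "(real \<Rightarrow> real) \<Rightarrow> (real \<Rightarrow> real) \<Rightarrow> ereal \<Rightarrow> ereal \<Rightarrow> nat \<Rightarrow> bool" where
  "upper_bound_on f g a r j \<longleftrightarrow>
     bound_regular f g a r j \<and>
     (\<forall>x\<in>einterval a r. deriv (iterate_P f g j) x + f x \<le> 0)"

definition lower_bound_on ::
  "(real \<Rightarrow> real) \<Rightarrow> (real \<Rightarrow> real) \<Rightarrow> ereal \<Rightarrow> ereal \<Rightarrow> nat \<Rightarrow> bool" where
  "lower_bound_on f g a r j \<longleftrightarrow>
     bound_regular f g a r j \<and>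
     (\<forall>x\<in>einterval a r. deriv (iterate_P f g j) x + f x \<ge> 0)"

text \<open>
  The reflection \<open>2 (1 - F) - P\<^sub>i\<close> of \<open>P\<^sub>i\<close> in the tail \<open>1 - F\<close>: it serves both as \<open>P\<^sub>L\<^sub>,\<^sub>i\<close> and
  as \<open>P\<^sub>U\<^sub>,\<^sub>i\<close>, which are given by the same formula.
\<close>

definition reflected_P ::
  "(real \<Rightarrow> real) \<Rightarrow> (real \<Rightarrow> real) \<Rightarrow> (real \<Rightarrow> real) \<Rightarrow> nat \<Rightarrow> real \<Rightarrow> real" where
  "reflected_P F f g i x = 2 * (1 - F x) - iterate_P f g i x"

end

theory Submission
  imports Defs
begin

text \<open>
  Put \<open>\<Psi> = P\<^sub>i + P\<^sub>i\<^sub>+\<^sub>1\<close>. The inequality \<open>P\<^sub>L\<^sub>,\<^sub>i \<le> P\<^sub>i\<^sub>+\<^sub>1\<close> says exactly that \<open>2 (1 - F) \<le> \<Psi>\<close>, and the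
  hypothesis \<open>\<Psi>' + 2 f \<le> 0\<close> says that \<open>\<Psi> - 2 (1 - F)\<close> is nonincreasing. Both \<open>\<Psi>\<close> and \<open>1 - F\<close> vanish
  at the right endpoint of the support, so this nonincreasing difference tends to \<open>0\<close> there and is
  therefore nonnegative. This is the argument behind the bound criterion itself, with \<open>2 (1 - F)\<close> in
  place of \<open>1 - F\<close>; lemma \<open>scaled_tail_le\<close> gives it for \<open>k (1 - F)\<close> with any real \<open>k\<close>. Part (i) is
  the case \<open>k = 2\<close>, and part (ii) is the case \<open>k = -2\<close> applied to \<open>-\<Psi>\<close>.

  That \<open>F\<close> tends to \<open>1\<close> at the right endpoint (lemma \<open>cdf_tendsto_1_at_right_endpoint\<close>) holds also
  for a finite endpoint, because \<open>X\<close> does not exceed it almost surely and its law has no atoms.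
\<close>

lemma limit_at_left_le_of_nonpos_deriv:
  fixes H :: "real \<Rightarrow> real" and c r :: ereal
  assumes deriv: "\<And>x. x \<in> einterval c r \<Longrightarrow> \<exists>d. (H has_real_derivative d) (at x) \<and> d \<le> 0"
    and lim: "((H \<circ> real_of_ereal) \<longlongrightarrow> L) (at_left r)"
    and x: "x \<in> einterval c r"
  shows "L \<le> H x"
proof -
  have le: "H y \<le> H x" if "x \<le> y" "ereal y < r" for y
  proof (rule DERIV_nonpos_imp_nonincreasing[OF that(1)])
    fix z assume "x \<le> z" "z \<le> y"
    then have "c < ereal z" "ereal z < r"
      using x that(2) le_less_trans[of "ereal z" "ereal y" r]
      by (auto simp: einterval_iff intro: less_le_trans)
    then show "\<exists>d. (H has_real_derivative d) (at z) \<and> d \<le> 0"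
      by (intro deriv) (simp add: einterval_iff)
  qed
  show ?thesis
  proof (cases r)
    case (real s)
    have "(H \<longlongrightarrow> L) (at_left s)"
      using lim by (simp add: real ereal_tendsto_simps)
    moreover have "eventually (\<lambda>y. H y \<le> H x) (at_left s)"
      using eventually_at_left_real[of x s] x
      by (auto simp: real einterval_iff intro: le elim!: eventually_mono)
    ultimately show ?thesis
      by (rule tendsto_upperbound) simp
  next
    case PInf
    have "(H \<longlongrightarrow> L) at_top"
      using lim by (simp add: PInf ereal_tendsto_simps)
    moreover have "eventually (\<lambda>y. H y \<le> H x) at_top"
      using eventually_ge_at_top[of x] by eventually_elim (simp add: le PInf)
    ultimately show ?thesis
      by (rule tendsto_upperbound) simp
  next
    case MInf
    then show ?thesis using x by (simp add: einterval_iff)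
  qed
qed

context interval_density
begin

text \<open>
  The left limit of a distribution function at \<open>s\<close> is the probability of \<open>X < s\<close>. For a finite
  endpoint \<open>s\<close> this is \<open>1\<close>, since on \<open>{s..}\<close> the density is zero except possibly at \<open>s\<close> itself.
\<close>

lemma cdf_tendsto_1_at_right_endpoint:
  "((cdf (distr M borel X) \<circ> real_of_ereal) \<longlongrightarrow> 1) (at_left r)"
proof -
  have X [measurable]: "random_variable borel X"
    using distributed_measurable[OF distributed_X] by simp
  interpret D: real_distribution "distr M borel X"
    by (rule real_distribution_distr) simp
  show ?thesis
  proof (cases r)
    case (real s)
    have "AE y in lborel. y \<in> {s..} \<longrightarrow> f y = 0"
      using AE_lborel_singleton[of s]
    proof eventually_elim
      case (elim y)
      show ?case
        using elim support_subset real by (fastforce simp: support_on_def)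
    qed
    then have "emeasure M (X -` {s..} \<inter> space M) = 0"
      by (subst distributed_emeasure[OF distributed_X])
         (auto intro!: nn_integral_zero' simp: indicator_def elim!: eventually_mono)
    then have "D.prob {s..} = 0"
      by (subst measure_distr) (simp_all add: measure_def)
    moreover have "D.prob {..<s} = 1 - D.prob {s..}"
      using D.prob_compl[of "{s..}"] by (simp add: Compl_eq_Diff_UNIV[symmetric])
    ultimately show ?thesis
      using D.cdf_at_left[of s] by (simp add: real ereal_tendsto_simps)
  next
    case PInf
    then show ?thesis
      using D.cdf_lim_at_top_prob by (simp add: ereal_tendsto_simps)
  next
    case MInf
    then show ?thesis using endpoints_less by simp
  qed
qed

text \<open>
  The factor \<open>k\<close> may be negative: replacing \<open>k\<close> and \<open>\<Psi>\<close> by their negatives turns this into the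
  comparison in the opposite direction.
\<close>

lemma scaled_tail_le:
  fixes \<Psi> :: "real \<Rightarrow> real" and k :: real
  assumes c: "l \<le> c"
    and diff: "\<And>x. x \<in> einterval c r \<Longrightarrow> (\<Psi> has_real_derivative \<Psi>' x) (at x)"
    and le: "\<And>x. x \<in> einterval c r \<Longrightarrow> \<Psi>' x + k * f x \<le> 0"
    and lim: "((\<Psi> \<circ> real_of_ereal) \<longlongrightarrow> 0) (at_left r)"
    and x: "x \<in> einterval c r"
  shows "k * (1 - cdf (distr M borel X) x) \<le> \<Psi> x"
proof -
  let ?F = "cdf (distr M borel X)"
  let ?H = "\<lambda>y. \<Psi> y - k * (1 - ?F y)"
  have "0 \<le> ?H x"
  proof (rule limit_at_left_le_of_nonpos_deriv[OF _ _ x])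
    fix y assume y: "y \<in> einterval c r"
    have "(?F has_real_derivative f y) (at y)"
      using y c by (intro cdf_deriv) (auto simp: einterval_iff intro: le_less_trans)
    then have "(?H has_real_derivative \<Psi>' y + k * f y) (at y)"
      using diff[OF y] by (auto intro!: derivative_eq_intros)
    then show "\<exists>d. (?H has_real_derivative d) (at y) \<and> d \<le> 0"
      using le[OF y] by blast
  next
    show "((?H \<circ> real_of_ereal) \<longlongrightarrow> 0) (at_left r)"
      using lim cdf_tendsto_1_at_right_endpoint
      unfolding comp_def by (auto intro!: tendsto_eq_intros)
  qed
  then show ?thesis by simp
qed

end

theorem lemma5:
  fixes M :: "'a measure" and X :: "'a \<Rightarrow> real" and f g F :: "real \<Rightarrow> real"
    and l r x\<^sub>i x\<^sub>i' x_hat :: ereal and i :: nat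
  assumes "interval_density M X f l r"
    and "F = cdf (distr M borel X)"
    and "x\<^sub>i \<in> {l..<r}" and "x\<^sub>i' \<in> {l..<r}"
    and "x_hat \<in> {max x\<^sub>i x\<^sub>i'..<r}"
  shows "(upper_bound_on f g x\<^sub>i r i \<and> lower_bound_on f g x\<^sub>i' r (Suc i) \<and>
          (\<forall>x\<in>einterval x_hat r.
             deriv (iterate_P f g (Suc i)) x + deriv (iterate_P f g i) x + 2 * f x \<le> 0) \<longrightarrow>
          (\<forall>x\<in>einterval x_hat r. reflected_P F f g i x \<le> iterate_P f g (Suc i) x))
       \<and> (lower_bound_on f g x\<^sub>i r i \<and> upper_bound_on f g x\<^sub>i' r (Suc i) \<and>
          (\<forall>x\<in>einterval x_hat r.
             deriv (iterate_P f g (Suc i)) x + deriv (iterate_P f g i) x + 2 * f x \<ge> 0) \<longrightarrow>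
          (\<forall>x\<in>einterval x_hat r. reflected_P F f g i x \<ge> iterate_P f g (Suc i) x))"
proof -
  interpret interval_density M X f l r by fact
  define P where "P = iterate_P f g i"
  define Q where "Q = iterate_P f g (Suc i)"
  let ?\<Psi> = "\<lambda>y. Q y + P y"
  let ?\<Psi>' = "\<lambda>y. deriv Q y + deriv P y"
  have l_le: "l \<le> x_hat"
    using assms(3,5) by auto
  have sum_deriv: "(?\<Psi> has_real_derivative ?\<Psi>' y) (at y)"
    and sum_lim: "((?\<Psi> \<circ> real_of_ereal) \<longlongrightarrow> 0) (at_left r)"
    if reg: "bound_regular f g x\<^sub>i r i" "bound_regular f g x\<^sub>i' r (Suc i)"
      and y: "y \<in> einterval x_hat r" for y
  proof -
    have "y \<in> einterval x\<^sub>i r" "y \<in> einterval x\<^sub>i' r"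
      using y assms(5) by (auto simp: einterval_iff intro: le_less_trans)
    then have "P differentiable at y" "Q differentiable at y"
      using reg unfolding bound_regular_def P_def Q_def by blast+
    then show "(?\<Psi> has_real_derivative ?\<Psi>' y) (at y)"
      by (intro DERIV_add) (auto simp: DERIV_deriv_iff_real_differentiable)
    show "((?\<Psi> \<circ> real_of_ereal) \<longlongrightarrow> 0) (at_left r)"
      using reg tendsto_add[of "P \<circ> real_of_ereal" 0 "at_left r" "Q \<circ> real_of_ereal" 0]
      unfolding bound_regular_def P_def Q_def comp_def by (simp add: add.commute)
  qed
  show ?thesis
  proof (intro conjI impI ballI; elim conjE)
    fix x assume x: "x \<in> einterval x_hat r"
      and bounds: "upper_bound_on f g x\<^sub>i r i" "lower_bound_on f g x\<^sub>i' r (Suc i)"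
      and le: "\<forall>x\<in>einterval x_hat r.
        deriv (iterate_P f g (Suc i)) x + deriv (iterate_P f g i) x + 2 * f x \<le> 0"
    have reg: "bound_regular f g x\<^sub>i r i" "bound_regular f g x\<^sub>i' r (Suc i)"
      using bounds by (simp_all add: upper_bound_on_def lower_bound_on_def)
    have "2 * (1 - F x) \<le> ?\<Psi> x"
      unfolding assms(2)
      by (rule scaled_tail_le[where \<Psi>' = ?\<Psi>', OF l_le sum_deriv[OF reg] _ sum_lim[OF reg x] x])
         (use le in \<open>auto simp: P_def Q_def\<close>)
    then show "reflected_P F f g i x \<le> iterate_P f g (Suc i) x"
      by (simp add: reflected_P_def P_def Q_def)
  next
    fix x assume x: "x \<in> einterval x_hat r"
      and bounds: "lower_bound_on f g x\<^sub>i r i" "upper_bound_on f g x\<^sub>i' r (Suc i)"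
      and ge: "\<forall>x\<in>einterval x_hat r.
        0 \<le> deriv (iterate_P f g (Suc i)) x + deriv (iterate_P f g i) x + 2 * f x"
    have reg: "bound_regular f g x\<^sub>i r i" "bound_regular f g x\<^sub>i' r (Suc i)"
      using bounds by (simp_all add: upper_bound_on_def lower_bound_on_def)
    have neg_lim: "(((\<lambda>y. - ?\<Psi> y) \<circ> real_of_ereal) \<longlongrightarrow> 0) (at_left r)"
      using tendsto_minus[OF sum_lim[OF reg x]] by (simp add: comp_def)
    have "-2 * (1 - F x) \<le> - ?\<Psi> x"
      unfolding assms(2)
    proof (rule scaled_tail_le[OF l_le _ _ neg_lim x])
      fix y assume y: "y \<in> einterval x_hat r"
      show "((\<lambda>y. - ?\<Psi> y) has_real_derivative - ?\<Psi>' y) (at y)"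
        by (rule DERIV_minus[OF sum_deriv[OF reg y]])
      show "- ?\<Psi>' y + -2 * f y \<le> 0"
        using ge y by (force simp: P_def Q_def)
    qed
    then show "iterate_P f g (Suc i) x \<le> reflected_P F f g i x"
      by (simp add: reflected_P_def P_def Q_def)
  qed
qed

end
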